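(* Let $k\ge 1$, let $n$ be a non-negative integer, and let $x_1,\dots,x_{k+1}$ be non-negative integers. Then $$\genfrac{[}{]}{0pt}{}{\sum_{i=1}^{k+1}x_i}{n}=\sum \tau_1^{\sum_{j=1}^{k}r_j(z_j-(n-s_j))}\,\tau_2^{\sum_{j=1}^{k}(n-s_j)(x_j-r_j)}\prod_{j=1}^{k+1}\genfrac{[}{]}{0pt}{}{x_j}{r_j}$$ and $$\genfrac{[}{]}{0pt}{}{\sum_{i=1}^{k+1}x_i}{n}=\sum \tau_1^{\sum_{j=1}^{k}(n-s_j)(x_j-r_j)}\,\tau_2^{\sum_{j=1}^{k}r_j(z_j-(n-s_j))}\prod_{j=1}^{k+1}\genfrac{[}{]}{0pt}{}{x_j}{r_j},$$ where both sums run over all $(r_1,\dots,r_k)$ with $r_j\in\{0,1,\dots,n\}$ and $\sum_{i=1}^k r_i\le n$, and where $s_j=\sum_{i=1}^{j}r_i$, $z_j=\sum_{i=j+1}^{k+1}x_i$ for $j\in\{1,\dots,k\}$, and $r_{k+1}=n-s_k$.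
   Context: $\mathcal R(p,q)$-deformed numbers: fix parameters $0<q<p<1$ and a function $\mathcal R$ such that $[x]=[x]_{\mathcal R(p,q)}:=\mathcal R(p^x,q^x)=\dfrac{\tau_1^x-\tau_2^x}{\tau_1-\tau_2}$, where $\tau_1\ne\tau_2$ are real numbers depending on $p,q$. Only $\tau_1,\tau_2$ matter here: they are nonzero distinct reals such that $[x]>0$ for every integer $x\ge1$, and the formula for $[x]$ is used for all integers $x$. Deformed factorial: $[r]!=[1][2]\cdots[r]$, $[0]!=1$. Deformed falling factorial of order $r\ge0$: $[x]_{r}=\prod_{i=0}^{r-1}[x-i]$, with $[x]_0=1$. Deformed binomial coefficient: $\genfrac{[}{]}{0pt}{}{x}{r}=\dfrac{[x]_r}{[r]!}$ (which equals $\frac{[x]!}{[r]!\,[x-r]!}$ for integers $x\ge r\ge0$, and is $0$ for integers $0\le x<r$). *)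

theory Defs
  imports Complex_Main "HOL-Library.FuncSet"
begin

text \<open>Deformed numbers, factorials, falling factorials and binomial coefficients; \<open>t1\<close>, \<open>t2\<close>
  stand for the values $\tau_1$, $\tau_2$ at the fixed parameters $p$, $q$, the only
  way in which $p$, $q$ and $\mathcal R$ enter.\<close>

definition dnum :: "real \<Rightarrow> real \<Rightarrow> int \<Rightarrow> real" where
  "dnum t1 t2 x = (t1 powi x - t2 powi x) / (t1 - t2)"

definition dfact :: "real \<Rightarrow> real \<Rightarrow> nat \<Rightarrow> real" where
  "dfact t1 t2 r = (\<Prod>i=1..r. dnum t1 t2 (int i))"

definition dffact :: "real \<Rightarrow> real \<Rightarrow> int \<Rightarrow> nat \<Rightarrow> real" where
  "dffact t1 t2 x r = (\<Prod>i<r. dnum t1 t2 (x - int i))"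

definition dbinom :: "real \<Rightarrow> real \<Rightarrow> int \<Rightarrow> nat \<Rightarrow> real" where
  "dbinom t1 t2 x r = dffact t1 t2 x r / dfact t1 t2 r"

text \<open>Index tuples $(r_1,\dots,r_k)$ are encoded as functions on \<open>{1..k}\<close>, extensional so that
  each tuple is counted exactly once.\<close>

definition tuples :: "nat \<Rightarrow> nat \<Rightarrow> (nat \<Rightarrow> nat) set" where
  "tuples k n = {r \<in> {1..k} \<rightarrow>\<^sub>E {0..n}. (\<Sum>i=1..k. r i) \<le> n}"

text \<open>The sums $s_j$ (\<open>psum r j\<close>) and $z_j$ (\<open>tsum k x j\<close>).\<close>

definition psum :: "(nat \<Rightarrow> nat) \<Rightarrow> nat \<Rightarrow> nat" where
  "psum r j = (\<Sum>i=1..j. r i)"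

definition tsum :: "nat \<Rightarrow> (nat \<Rightarrow> nat) \<Rightarrow> nat \<Rightarrow> nat" where
  "tsum k x j = (\<Sum>i=j+1..k+1. x i)"

text \<open>Appends the last entry $r_{k+1} = n - s_k$; the natural-number subtraction does not truncate
  for \<open>r \<in> tuples k n\<close>.\<close>

definition extend_idx :: "nat \<Rightarrow> nat \<Rightarrow> (nat \<Rightarrow> nat) \<Rightarrow> nat \<Rightarrow> nat" where
  "extend_idx k n r = r(k + 1 := n - psum r k)"

text \<open>The two exponents are integers and may be negative; this happens only for tuples
  whose product of binomial coefficients vanishes.\<close>

definition expo_rz :: "nat \<Rightarrow> nat \<Rightarrow> (nat \<Rightarrow> nat) \<Rightarrow> (nat \<Rightarrow> nat) \<Rightarrow> int" where
  "expo_rz k n x r =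
     (\<Sum>j=1..k. int (r j) * (int (tsum k x j) - (int n - int (psum r j))))"

definition expo_sx :: "nat \<Rightarrow> nat \<Rightarrow> (nat \<Rightarrow> nat) \<Rightarrow> (nat \<Rightarrow> nat) \<Rightarrow> int" where
  "expo_sx k n x r =
     (\<Sum>j=1..k. (int n - int (psum r j)) * (int (x j) - int (r j)))"

end

theory Submission
  imports Defs
begin

text \<open>The two-part case is the deformed Vandermonde convolution, proved by induction on the first
  part with the deformed Pascal rule. For more parts, merge the last two parts
  \<open>x k\<close> and \<open>x (k + 1)\<close> into one, apply the induction hypothesis and expand the last factor by
  the two-part case: this leaves \<open>s\<^sub>j\<close> and \<open>z\<^sub>j\<close> for \<open>j < k\<close> unchanged. The second
  identity is the first one with \<open>\<tau>\<^sub>1\<close> and \<open>\<tau>\<^sub>2\<close> exchanged.\<close>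

section \<open>Deformed numbers and binomials: symmetry, addition, Pascal, Vandermonde\<close>

lemma dnum_swap: "dnum t1 t2 x = dnum t2 t1 x"
  unfolding dnum_def by (metis minus_diff_eq minus_divide_divide)

lemma dbinom_swap: "dbinom t1 t2 x r = dbinom t2 t1 x r"
  by (simp add: dbinom_def dffact_def dfact_def dnum_swap[of t1 t2])

lemma dnum_0 [simp]: "dnum t1 t2 0 = 0"
  by (simp add: dnum_def)

lemma dbinom_0_right [simp]: "dbinom t1 t2 x 0 = 1"
  by (simp add: dbinom_def dffact_def dfact_def)

lemma dbinom_0_Suc [simp]: "dbinom t1 t2 0 (Suc r) = 0"
  by (simp add: dbinom_def dffact_def prod.lessThan_Suc_shift del: prod.lessThan_Suc)

text \<open>The mixed terms \<open>t1 powi a * t2 powi b\<close> on the right cancel, which leaves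
  the numerator of \<open>dnum t1 t2 (a + b)\<close>.\<close>

lemma dnum_add:
  assumes "t1 \<noteq> 0" "t2 \<noteq> 0" "t1 \<noteq> t2"
  shows "dnum t1 t2 (a + b) = t2 powi b * dnum t1 t2 a + t1 powi a * dnum t1 t2 b"
  using assms
  by (simp add: dnum_def power_int_add add_divide_distrib[symmetric] algebra_simps)

text \<open>All three binomials share the factor \<open>dffact t1 t2 x r\<close>: the left one loses
  its first factor, \<open>dbinom t1 t2 x (Suc r)\<close> its last. What remains is
  \<open>dnum_add\<close> for the splitting of \<open>x + 1\<close> into \<open>x - int r\<close>
  and \<open>int r + 1\<close>.\<close>

lemma dbinom_Pascal:
  assumes "t1 \<noteq> 0" "t2 \<noteq> 0" "t1 \<noteq> t2" and nz: "\<forall>m\<ge>1. dnum t1 t2 m \<noteq> 0"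
  shows "dbinom t1 t2 (x + 1) (Suc r) =
    t2 powi (int r + 1) * dbinom t1 t2 x (Suc r) + t1 powi (x - int r) * dbinom t1 t2 x r"
proof -
  have F: "dfact t1 t2 r \<noteq> 0" "dnum t1 t2 (int (Suc r)) \<noteq> 0"
    using nz by (auto simp: dfact_def)
  have fact: "dfact t1 t2 (Suc r) = dnum t1 t2 (int (Suc r)) * dfact t1 t2 r"
    by (simp add: dfact_def)
  have up: "dffact t1 t2 (x + 1) (Suc r) = dnum t1 t2 (x + 1) * dffact t1 t2 x r"
    by (simp add: dffact_def prod.lessThan_Suc_shift del: prod.lessThan_Suc)
  have low: "dffact t1 t2 x (Suc r) = dnum t1 t2 (x - int r) * dffact t1 t2 x r"
    by (simp add: dffact_def)
  have "dnum t1 t2 (x + 1) = t2 powi (int r + 1) * dnum t1 t2 (x - int r)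
      + t1 powi (x - int r) * dnum t1 t2 (int (Suc r))"
    using dnum_add[OF assms(1-3), of "x - int r" "int r + 1"] by (simp add: add.commute)
  then show ?thesis
    unfolding dbinom_def fact up low using F by (simp add: field_simps)
qed

lemma dbinom_Vandermonde:
  assumes t: "t1 \<noteq> 0" "t2 \<noteq> 0" "t1 \<noteq> t2" and nz: "\<forall>m\<ge>1. dnum t1 t2 m \<noteq> 0"
  shows "dbinom t1 t2 (int x + y) n =
    (\<Sum>r\<le>n. t1 powi (int r * (y - (int n - int r))) * t2 powi ((int n - int r) * (int x - int r)) *
      (dbinom t1 t2 (int x) r * dbinom t1 t2 y (n - r)))"
proof (induction x arbitrary: n)
  case 0
  \<comment> \<open>Only the term \<open>r = 0\<close> survives, since
    \<open>dbinom t1 t2 0 (Suc r)\<close> vanishes.\<close>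
  show ?case by (cases n) (simp_all add: sum.atMost_Suc_shift del: sum.atMost_Suc)
next
  case (Suc x)
  show ?case
  proof (cases n)
    case 0
    then show ?thesis by simp
  next
    case (Suc m)
    define T where "T x n r = t1 powi (int r * (y - (int n - int r))) *
      t2 powi ((int n - int r) * (int x - int r)) *
      (dbinom t1 t2 (int x) r * dbinom t1 t2 y (n - r))" for x n r :: nat
    have pw: "t powi a * t powi b = t powi (a + b)" if "t \<noteq> 0" for t :: real and a b
      using that by (simp add: power_int_add)
    have pascal: "dbinom t1 t2 (int (Suc x)) (Suc r) = t2 powi (int r + 1) *
        dbinom t1 t2 (int x) (Suc r) + t1 powi (int x - int r) * dbinom t1 t2 (int x) r" for r
      using dbinom_Pascal[OF t nz, of "int x" r] by (simp add: add.commute)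
    \<comment> \<open>Pascal's rule splits the binomial in \<open>x\<close>. After regrouping the
      powers, the two coefficients no longer depend on \<open>r\<close>, and they are those of
      Pascal's rule for \<open>int x + y\<close>; so they come out of the sum and the rule can be
      applied backwards.\<close>
    have step: "T (Suc x) (Suc m) (Suc r) = t2 powi (int m + 1) * T x (Suc m) (Suc r)
        + t1 powi (int x + y - int m) * T x m r" for r
    proof -
      have e1: "t2 powi ((int m - int r) * (int x - int r)) * t2 powi (int r + 1) =
          t2 powi (int m + 1) * t2 powi ((int m - int r) * (int x - int (Suc r)))"
        unfolding pw[OF t(2)] by (rule arg_cong[of _ _ "(powi) t2"]) (simp add: algebra_simps)
      have e2: "t1 powi (int (Suc r) * (y - (int m - int r))) * t1 powi (int x - int r) =
          t1 powi (int x + y - int m) * t1 powi (int r * (y - (int m - int r)))"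
        unfolding pw[OF t(1)] by (rule arg_cong[of _ _ "(powi) t1"]) (simp add: algebra_simps)
      have d: "int (Suc m) - int (Suc r) = int m - int r" "int (Suc x) - int (Suc r) = int x - int r"
        by simp_all
      show ?thesis
        unfolding T_def pascal d diff_Suc_Suc using e1 e2 by algebra
    qed
    \<comment> \<open>At \<open>r = 0\<close> the binomial in \<open>x\<close> is 1 and does not
      split; the term just gains the coefficient it needs to complete the sum for
      \<open>Suc m\<close>.\<close>
    have first: "T (Suc x) (Suc m) 0 = t2 powi (int m + 1) * T x (Suc m) 0"
    proof -
      have "t2 powi (int (Suc m) * int (Suc x)) = t2 powi (int m + 1) * t2 powi (int (Suc m) * int x)"
        unfolding pw[OF t(2)] by (rule arg_cong[of _ _ "(powi) t2"]) (simp add: algebra_simps)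
      then show ?thesis by (simp add: T_def)
    qed
    have "(\<Sum>r\<le>Suc m. T (Suc x) (Suc m) r) =
        T (Suc x) (Suc m) 0 + (\<Sum>r\<le>m. T (Suc x) (Suc m) (Suc r))"
      by (rule sum.atMost_Suc_shift)
    also have "\<dots> = t2 powi (int m + 1) * (T x (Suc m) 0 + (\<Sum>r\<le>m. T x (Suc m) (Suc r)))
        + t1 powi (int x + y - int m) * (\<Sum>r\<le>m. T x m r)"
      unfolding step first by (simp only: sum.distrib sum_distrib_left distrib_left add.assoc)
    also have "T x (Suc m) 0 + (\<Sum>r\<le>m. T x (Suc m) (Suc r)) = (\<Sum>r\<le>Suc m. T x (Suc m) r)"
      by (rule sum.atMost_Suc_shift[symmetric])
    also have "(\<Sum>r\<le>Suc m. T x (Suc m) r) = dbinom t1 t2 (int x + y) (Suc m)"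
      unfolding T_def by (rule Suc.IH[symmetric])
    also have "(\<Sum>r\<le>m. T x m r) = dbinom t1 t2 (int x + y) m"
      unfolding T_def by (rule Suc.IH[symmetric])
    also have "t2 powi (int m + 1) * dbinom t1 t2 (int x + y) (Suc m)
        + t1 powi (int x + y - int m) * dbinom t1 t2 (int x + y) m
        = dbinom t1 t2 (int (Suc x) + y) (Suc m)"
      using dbinom_Pascal[OF t nz, of "int x + y" m] by (simp add: algebra_simps)
    finally show ?thesis
      unfolding T_def Suc ..
  qed
qed

section \<open>Index tuples and their partial sums\<close>

lemma psum_upd: "j < i \<Longrightarrow> psum (r(i := c)) j = psum r j"
  unfolding psum_def by (rule sum.cong) auto

lemma psum_Suc: "psum r (Suc k) = psum r k + r (Suc k)"
  by (simp add: psum_def)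

text \<open>The entries are natural numbers, so a bound on their sum bounds each of them.\<close>

lemma tuples_iff:
  "r \<in> tuples k n \<longleftrightarrow> r \<in> extensional {1..k} \<and> psum r k \<le> n"
proof -
  have "r i \<le> n" if "psum r k \<le> n" "i \<in> {1..k}" for i
    using member_le_sum[of i "{1..k}" r] that by (simp add: psum_def)
  then show ?thesis
    unfolding tuples_def psum_def[symmetric] by (auto simp: PiE_iff)
qed

lemma finite_tuples: "finite (tuples k n)"
  unfolding tuples_def
  by (rule finite_subset[of _ "{1..k} \<rightarrow>\<^sub>E {0..n}"]) (auto intro: finite_PiE)

lemma tuples_0: "tuples 0 n = {\<lambda>_. undefined}"
  by (auto simp: tuples_iff psum_def)

text \<open>The last entry \<open>c\<close> ranges over whatever the first \<open>k\<close> entries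
  leave of \<open>n\<close>.\<close>

lemma sum_tuples_Suc:
  "(\<Sum>r\<in>tuples (Suc k) n. f r) = (\<Sum>r\<in>tuples k n. \<Sum>c\<le>n - psum r k. f (r(Suc k := c)))"
proof -
  have "(\<Sum>r\<in>tuples k n. \<Sum>c\<le>n - psum r k. f (r(Suc k := c))) =
      (\<Sum>(r, c)\<in>Sigma (tuples k n) (\<lambda>r. {..n - psum r k}). f (r(Suc k := c)))"
    by (rule sum.Sigma) (auto simp: finite_tuples)
  also have "\<dots> = (\<Sum>r\<in>tuples (Suc k) n. f r)"
  \<comment> \<open>Cutting off the last entry resets it to \<open>undefined\<close>, which makes
    the shorter tuple extensional again.\<close>
  proof (rule sum.reindex_bij_witness[of _
        "\<lambda>r. (r(Suc k := undefined), r (Suc k))" "\<lambda>(r, c). r(Suc k := c)"], goal_cases)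
    case (1 a)
    then show ?case
      by (auto simp: tuples_iff extensional_def fun_eq_iff)
  next
    case (2 a)
    then show ?case
      by (auto simp: tuples_iff extensional_def psum_Suc psum_upd split: prod.splits)
  next
    case (3 b)
    then show ?case by simp
  next
    case (4 b)
    then show ?case
      by (auto simp: tuples_iff extensional_def psum_Suc psum_upd)
  next
    case (5 a)
    then show ?case by (simp split: prod.splits)
  qed
  finally show ?thesis ..
qed

section \<open>Tail sums and exponents when the last two parts are merged\<close>

lemma tsum_merge:
  assumes "j \<le> k"
  shows "tsum k (x(Suc k := x (Suc k) + x (Suc (Suc k)))) j = tsum (Suc k) x j"
proof -
  have "(\<Sum>i=j+1..k. (x(Suc k := x (Suc k) + x (Suc (Suc k)))) i) = (\<Sum>i=j+1..k. x i)"
    by (rule sum.cong) auto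
  then show ?thesis
    using assms by (simp add: tsum_def)
qed

text \<open>The summands with \<open>j \<le> k\<close> see the last two parts only through tail sums
  that contain both. The new summand is the exponent of \<open>t1\<close> in
  \<open>dbinom_Vandermonde\<close>, with \<open>n - psum r k\<close> in the role of
  \<open>n\<close>.\<close>

lemma expo_rz_Suc:
  assumes "psum r k \<le> n" "c \<le> n - psum r k"
  shows "expo_rz (Suc k) n x (r(Suc k := c)) =
    expo_rz k n (x(Suc k := x (Suc k) + x (Suc (Suc k)))) r +
    int c * (int (x (Suc (Suc k))) - (int (n - psum r k) - int c))"
proof -
  have "(\<Sum>j=1..k. int ((r(Suc k := c)) j) *
      (int (tsum (Suc k) x j) - (int n - int (psum (r(Suc k := c)) j)))) =
      expo_rz k n (x(Suc k := x (Suc k) + x (Suc (Suc k)))) r"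
    unfolding expo_rz_def by (rule sum.cong) (auto simp: psum_upd tsum_merge)
  then show ?thesis
    using assms by (simp add: expo_rz_def psum_Suc psum_upd tsum_def of_nat_diff algebra_simps)
qed

text \<open>Merging leaves \<open>x j\<close> alone for \<open>j \<le> k\<close>; the new summand is
  the exponent of \<open>t2\<close> in \<open>dbinom_Vandermonde\<close>.\<close>

lemma expo_sx_Suc:
  assumes "psum r k \<le> n" "c \<le> n - psum r k"
  shows "expo_sx (Suc k) n x (r(Suc k := c)) =
    expo_sx k n (x(Suc k := x (Suc k) + x (Suc (Suc k)))) r +
    (int (n - psum r k) - int c) * (int (x (Suc k)) - int c)"
proof -
  have "(\<Sum>j=1..k. (int n - int (psum (r(Suc k := c)) j)) * (int (x j) - int ((r(Suc k := c)) j))) =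
      expo_sx k n (x(Suc k := x (Suc k) + x (Suc (Suc k)))) r"
    unfolding expo_sx_def by (rule sum.cong) (auto simp: psum_upd)
  then show ?thesis
    using assms by (simp add: expo_sx_def psum_Suc psum_upd of_nat_diff algebra_simps)
qed

section \<open>The convolution for several parts\<close>

lemma dbinom_multi_Vandermonde:
  assumes t: "t1 \<noteq> 0" "t2 \<noteq> 0" "t1 \<noteq> t2" and nz: "\<forall>m\<ge>1. dnum t1 t2 m \<noteq> 0"
  shows "dbinom t1 t2 (int (\<Sum>i=1..k+1. x i)) n =
    (\<Sum>r\<in>tuples k n. t1 powi expo_rz k n x r * t2 powi expo_sx k n x r *
      (\<Prod>j=1..k+1. dbinom t1 t2 (int (x j)) (extend_idx k n r j)))"
proof (induction k arbitrary: x)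
  case 0
  show ?case
    \<comment> \<open>The only tuple is the empty one, and the entry appended to it is
      \<open>n\<close>.\<close>
    by (simp add: tuples_0 expo_rz_def expo_sx_def extend_idx_def psum_def)
next
  case (Suc k)
  define x' where "x' = x(Suc k := x (Suc k) + x (Suc (Suc k)))"
  \<comment> \<open>\<open>B r\<close> collects the factors that merging does not touch.\<close>
  define B where "B r = (\<Prod>j=1..k. dbinom t1 t2 (int (x j)) (r j))" for r
  have prod_Suc: "(\<Prod>j=1..Suc k+1. dbinom t1 t2 (int (x j)) (extend_idx (Suc k) n (r(Suc k := c)) j)) =
      B r * (dbinom t1 t2 (int (x (Suc k))) c * dbinom t1 t2 (int (x (Suc (Suc k)))) (n - psum r k - c))"
    for r c
  proof -
    have "(\<Prod>j=1..k. dbinom t1 t2 (int (x j)) (extend_idx (Suc k) n (r(Suc k := c)) j)) = B r"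
      unfolding B_def by (rule prod.cong) (auto simp: extend_idx_def)
    then show ?thesis
      by (simp add: extend_idx_def psum_Suc psum_upd mult.assoc)
  qed
  have prod_k: "(\<Prod>j=1..k+1. dbinom t1 t2 (int (x' j)) (extend_idx k n r j)) =
      B r * dbinom t1 t2 (int (x (Suc k)) + int (x (Suc (Suc k)))) (n - psum r k)" for r
  proof -
    have "(\<Prod>j=1..k. dbinom t1 t2 (int (x' j)) (extend_idx k n r j)) = B r"
      unfolding B_def by (rule prod.cong) (auto simp: extend_idx_def x'_def)
    then show ?thesis
      by (simp add: extend_idx_def x'_def)
  qed
  have "(\<Sum>i=1..k. x' i) = (\<Sum>i=1..k. x i)"
    by (rule sum.cong) (auto simp: x'_def)
  then have "(\<Sum>i=1..Suc k+1. x i) = (\<Sum>i=1..k+1. x' i)"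
    by (simp add: x'_def)
  then have "dbinom t1 t2 (int (\<Sum>i=1..Suc k+1. x i)) n =
      (\<Sum>r\<in>tuples k n. t1 powi expo_rz k n x' r * t2 powi expo_sx k n x' r *
        (\<Prod>j=1..k+1. dbinom t1 t2 (int (x' j)) (extend_idx k n r j)))"
    using Suc.IH[of x'] by simp
  also have "\<dots> = (\<Sum>r\<in>tuples k n. \<Sum>c\<le>n - psum r k.
      t1 powi expo_rz (Suc k) n x (r(Suc k := c)) * t2 powi expo_sx (Suc k) n x (r(Suc k := c)) *
      (\<Prod>j=1..Suc k+1. dbinom t1 t2 (int (x j)) (extend_idx (Suc k) n (r(Suc k := c)) j)))"
  proof (rule sum.cong[OF refl], goal_cases)
    case (1 r)
    then have r: "psum r k \<le> n" by (simp add: tuples_iff)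
    show ?case
      \<comment> \<open>The merged parts occur in a single binomial of order
        \<open>n - psum r k\<close>; its expansion produces the inner sum over \<open>c\<close>, and
        both sides then agree term by term.\<close>
      unfolding prod_k prod_Suc dbinom_Vandermonde[OF t nz] sum_distrib_left
    proof (rule sum.cong[OF refl], goal_cases)
      case (1 c)
      then have c: "c \<le> n - psum r k" by simp
      show ?case
        unfolding expo_rz_Suc[OF r c] expo_sx_Suc[OF r c] x'_def
        using t by (simp add: power_int_add)
    qed
  qed
  finally show ?case
    unfolding sum_tuples_Suc .
qed

theorem corollary2p10:
  fixes t1 t2 :: real and k n :: nat and x :: "nat \<Rightarrow> nat"
  assumes "t1 \<noteq> 0" and "t2 \<noteq> 0" and "t1 \<noteq> t2"
    and "\<And>m::int. m \<ge> 1 \<Longrightarrow> dnum t1 t2 m > 0"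
    and "k \<ge> 1"
  shows "dbinom t1 t2 (int (\<Sum>i=1..k+1. x i)) n =
           (\<Sum>r\<in>tuples k n. t1 powi expo_rz k n x r * t2 powi expo_sx k n x r *
              (\<Prod>j=1..k+1. dbinom t1 t2 (int (x j)) (extend_idx k n r j)))
       \<and> dbinom t1 t2 (int (\<Sum>i=1..k+1. x i)) n =
           (\<Sum>r\<in>tuples k n. t1 powi expo_sx k n x r * t2 powi expo_rz k n x r *
              (\<Prod>j=1..k+1. dbinom t1 t2 (int (x j)) (extend_idx k n r j)))"
proof -
  have nz: "\<forall>m\<ge>1. dnum t1 t2 m \<noteq> 0"
    using assms(4) by (metis less_irrefl)
  then have nz': "\<forall>m\<ge>1. dnum t2 t1 m \<noteq> 0"
    by (simp add: dnum_swap[of t2 t1])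
  show ?thesis
    \<comment> \<open>In the second instance the binomials are unchanged by symmetry, and only the
      order of the two powers has to be restored.\<close>
    using dbinom_multi_Vandermonde[OF assms(1-3) nz, of x k n]
      dbinom_multi_Vandermonde[OF assms(2,1) assms(3)[symmetric] nz', of x k n]
    by (simp add: dbinom_swap[of t2 t1] mult.commute[of "t2 powi _"])
qed

end
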